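(* Up to isomorphism, the connected $6$-regular strongly regular signed graphs that are $0$ net-regular (every vertex is incident with exactly $3$ positive and $3$ negative edges) are precisely $\dot{S}^4_8$, $-\dot{S}^4_8$, $\dot{S}_{16}$ and $-\dot{S}_{16}$, where these are defined as follows. - $\dot{S}^4_8$, with parameters $(8,6,4,-4,-6)$. The vertices are $x_1,\dots,x_4,y_1,\dots,y_4$. The edges $x_ix_j$ and $y_iy_j$ ($i\ne j$) are positive, so the positive edges form two disjoint copies of $K_4$. The edges $x_iy_j$ with $i\ne j$ are negative. The pairs $x_i,y_i$ are non-adjacent. - $\dot{S}_{16}$, with parameters $(16,6,2,2,-2)$. The vertices are $(i,j)$ with $i,j\in\{1,2,3,4\}$. The vertex $(i,j)$ is joined to $(i,j')$ by a positive edge for $j'\neq j$, and to $(i',j)$ by a negative edge for $i'\ne i$. There are no other edges, so the underlying graph is $K_4\,\square\,K_4$.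
   Context: Signed graphs. - A signed graph $\dot G=(G,\sigma)$ is a simple graph $G$ (the underlying graph) together with a sign function $\sigma:E(G)\to\{+1,-1\}$. - Its adjacency matrix $A(\dot G)$ has $(i,j)$-entry $\sigma(v_iv_j)$ if $v_i\sim v_j$ and $0$ otherwise. - Connectedness, completeness and $r$-regularity of $\dot G$ refer to $G$. - The net-degree of a vertex $v$ is $d^+(v)-d^-(v)$, where $d^{\pm}(v)$ are the numbers of positive and negative edges at $v$. $\dot G$ is $\rho$ net-regular if every vertex has net-degree $\rho$. - $\dot G$ is homogeneous if all its edges have the same sign. - The negation $-\dot G$ is obtained by reversing the sign of every edge. - Two signed graphs are isomorphic if there is an isomorphism of the underlying graphs preserving edge signs. Strongly regular signed graphs. - A signed graph $\dot G$ on $n$ vertices is a strongly regular signed graph (SRSG) if it is neither homogeneous complete nor edgeless, and there exist $r\in\mathbb N$ and $a,b,c\in\mathbb Z$ such that the $(i,j)$-entry of $A(\dot G)^2$ equals: - $r$ if $v_i=v_j$; - $a$ if $v_i$ and $v_j$ are joined by a positive edge; - $b$ if $v_i$ and $v_j$ are joined by a negative edge; - $c$ if $v_i\neq v_j$ are non-adjacent. - $(n,r,a,b,c)$ are called its parameters. *)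

theory Defs
  imports "HOL-Analysis.Analysis"
begin

text \<open>The vertex set is the whole (finite) type \<open>'v\<close>. Edges are two-element sets of vertices;
  the values of \<open>esign\<close> on sets that are not edges are irrelevant.\<close>

record 'v sgraph =
  edges :: "'v set set"
  esign :: "'v set \<Rightarrow> int"

definition signed_graph :: "'v sgraph \<Rightarrow> bool" where
  "signed_graph G \<longleftrightarrow> (\<forall>e \<in> edges G. card e = 2 \<and> esign G e \<in> {1, -1})"

definition adjacent :: "'v sgraph \<Rightarrow> 'v \<Rightarrow> 'v \<Rightarrow> bool" where
  "adjacent G u v \<longleftrightarrow> {u, v} \<in> edges G"

definition adj_matrix :: "'v::finite sgraph \<Rightarrow> int ^ 'v ^ 'v" where
  "adj_matrix G = (\<chi> u v. if adjacent G u v then esign G {u, v} else 0)"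

definition sg_connected :: "'v sgraph \<Rightarrow> bool" where
  "sg_connected G \<longleftrightarrow> (\<forall>u v. (adjacent G)\<^sup>*\<^sup>* u v)"

definition sg_complete :: "'v sgraph \<Rightarrow> bool" where
  "sg_complete G \<longleftrightarrow> (\<forall>u v. u \<noteq> v \<longrightarrow> adjacent G u v)"

definition sg_regular :: "'v sgraph \<Rightarrow> nat \<Rightarrow> bool" where
  "sg_regular G r \<longleftrightarrow> (\<forall>v. card {e \<in> edges G. v \<in> e} = r)"

definition pos_degree :: "'v sgraph \<Rightarrow> 'v \<Rightarrow> nat" where
  "pos_degree G v = card {e \<in> edges G. v \<in> e \<and> esign G e = 1}"

definition neg_degree :: "'v sgraph \<Rightarrow> 'v \<Rightarrow> nat" where
  "neg_degree G v = card {e \<in> edges G. v \<in> e \<and> esign G e = -1}"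

definition net_degree :: "'v sgraph \<Rightarrow> 'v \<Rightarrow> int" where
  "net_degree G v = int (pos_degree G v) - int (neg_degree G v)"

definition net_regular :: "'v sgraph \<Rightarrow> int \<Rightarrow> bool" where
  "net_regular G \<rho> \<longleftrightarrow> (\<forall>v. net_degree G v = \<rho>)"

definition homogeneous :: "'v sgraph \<Rightarrow> bool" where
  "homogeneous G \<longleftrightarrow> (\<forall>e \<in> edges G. \<forall>e' \<in> edges G. esign G e = esign G e')"

definition negation :: "'v sgraph \<Rightarrow> 'v sgraph" where
  "negation G = \<lparr>edges = edges G, esign = (\<lambda>e. - esign G e)\<rparr>"

definition sg_isomorphic :: "'v sgraph \<Rightarrow> 'w sgraph \<Rightarrow> bool" where
  "sg_isomorphic G H \<longleftrightarrow> (\<exists>f :: 'v \<Rightarrow> 'w. bij f \<and>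
     (\<forall>u v. adjacent G u v \<longleftrightarrow> adjacent H (f u) (f v)) \<and>
     (\<forall>u v. adjacent G u v \<longrightarrow> esign H {f u, f v} = esign G {u, v}))"

definition srsg_with_params ::
    "'v::finite sgraph \<Rightarrow> nat \<Rightarrow> nat \<Rightarrow> int \<Rightarrow> int \<Rightarrow> int \<Rightarrow> bool" where
  "srsg_with_params G n r a b c \<longleftrightarrow>
     signed_graph G \<and> CARD('v) = n \<and>
     \<not> (homogeneous G \<and> sg_complete G) \<and> edges G \<noteq> {} \<and>
     (\<forall>u v. (adj_matrix G ** adj_matrix G) $ u $ v =
        (if u = v then int r
         else if adjacent G u v then (if esign G {u, v} = 1 then a else b)
         else c))"

definition strongly_regular :: "'v::finite sgraph \<Rightarrow> bool" where
  "strongly_regular G \<longleftrightarrow> (\<exists>n r a b c. srsg_with_params G n r a b c)"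

text \<open>\<open>Inl i\<close> and \<open>Inr i\<close> are the vertices \<open>x\<^sub>i\<close> and \<open>y\<^sub>i\<close>. The four-element type \<open>4\<close> serves
  as index set; its arithmetic (modulo 4) plays no role.\<close>

definition S8_pos_edges :: "(4 + 4) set set" where
  "S8_pos_edges = {{Inl i, Inl j} | i j. i \<noteq> j} \<union> {{Inr i, Inr j} | i j. i \<noteq> j}"

definition S8_neg_edges :: "(4 + 4) set set" where
  "S8_neg_edges = {{Inl i, Inr j} | i j. i \<noteq> j}"

definition S8 :: "(4 + 4) sgraph" where
  "S8 = \<lparr>edges = S8_pos_edges \<union> S8_neg_edges,
         esign = (\<lambda>e. if e \<in> S8_pos_edges then 1 else -1)\<rparr>"

definition S16_pos_edges :: "(4 \<times> 4) set set" where
  "S16_pos_edges = {{(i, j), (i, j')} | i j j'. j' \<noteq> j}"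

definition S16_neg_edges :: "(4 \<times> 4) set set" where
  "S16_neg_edges = {{(i, j), (i', j)} | i i' j. i' \<noteq> i}"

definition S16 :: "(4 \<times> 4) sgraph" where
  "S16 = \<lparr>edges = S16_pos_edges \<union> S16_neg_edges,
          esign = (\<lambda>e. if e \<in> S16_pos_edges then 1 else -1)\<rparr>"

end

theory Submission
  imports Defs
begin

text \<open>Let \<open>M\<close> be the signed adjacency matrix. Since \<open>M\<^sup>2\<close> is a combination of \<open>I\<close>, \<open>M\<close>,
  \<open>\<bar>M\<bar>\<close> and the all-one matrix \<open>J\<close>, and \<open>M J = J M = 0\<close>, the matrix \<open>M\<close> commutes with
  \<open>(a + b - 2 c) \<bar>M\<bar>\<close>; counting entries of a row of \<open>M\<^sup>2\<close> gives
  \<open>6 + 3 (a + b) + c (n - 7) = 0\<close>, which together with the parity of \<open>n\<close> shows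
  \<open>a + b \<noteq> 2 c\<close>. Hence \<open>M\<close> commutes with \<open>\<bar>M\<bar>\<close>. Comparing the entries of \<open>M\<^sup>2\<close> and of
  \<open>M \<bar>M\<bar> = \<bar>M\<bar> M\<close> at a vertex and its six neighbours, and assuming \<open>a \<ge> b\<close> (negation swaps
  \<open>a\<close> and \<open>b\<close>), leaves five possibilities for \<open>(a, b)\<close> and the signs inside a neighbourhood.
  Three of them are impossible. In the other two the positive edges form copies of \<open>K\<^sub>4\<close>, and
  divisibility determines \<open>n\<close>: for \<open>a = b = 2\<close> the negative edges also form copies of \<open>K\<^sub>4\<close>,
  \<open>n = 16\<close>, and a vertex is determined by its two cliques; for \<open>a = 4\<close>, \<open>b = -4\<close> one gets
  \<open>n = 8\<close> and two positive cliques matched by non-adjacency.\<close>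

section \<open>Parity and the arithmetic of one neighbourhood\<close>

text \<open>Enlarging \<open>S\<close> by \<open>x\<close> adds a row and an equal column, so
  off-diagonal terms come in pairs. For the indicator of positive edges this is the handshake
  argument.\<close>

lemma even_sum_symmetric:
  fixes f :: "'a \<Rightarrow> 'a \<Rightarrow> int"
  assumes "finite S" "\<And>u v. f u v = f v u" "\<And>u. f u u = 0"
  shows "even (\<Sum>u\<in>S. \<Sum>v\<in>S. f u v)"
  using assms(1)
proof (induction S)
  case (insert x S)
  have "(\<Sum>u\<in>S. f u x) = (\<Sum>u\<in>S. f x u)" using assms(2) by simp
  with insert assms(3) show ?case by (simp add: sum.distrib)
qed simp

text \<open>In the next three lemmas \<open>x\<^sub>i\<close> are the entries of \<open>M\<close> between the three positive neighbours of
  a vertex and \<open>y\<^sub>i\<close> those between the three negative ones, indexed by the pairs \<open>12\<close>, \<open>13\<close>, \<open>23\<close>.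
  The entries between positive and negative neighbours enter only through the row sums \<open>R\<^sub>i\<close> and
  column sums \<open>T\<^sub>i\<close>, and the row and column sums \<open>U\<^sub>i\<close>, \<open>V\<^sub>i\<close> of their absolute values.\<close>

lemma pair_local_analysis:
  fixes x y R U a :: int
  assumes "x = -1 \<or> x = 0 \<or> x = 1" "y = -1 \<or> y = 0 \<or> y = 1"
    and "a = x + y - R" "even a" "\<bar>x\<bar> + \<bar>y\<bar> - U = x + y + R" "\<bar>R\<bar> \<le> U" "U \<le> 3"
  shows "a = -4 \<and> x + y = -2 \<or> a = -2 \<and> x + y = -1 \<or> a = 0 \<and> x + y \<in> {-1..0} \<or>
    a = 2 \<and> x \<ge> 0 \<and> y \<ge> 0 \<or> a = 4 \<and> x + y \<in> {1..2}"
proof -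
  \<comment> \<open>Once \<open>a\<close> is halved, the two equations express \<open>R\<close> and
    \<open>U\<close> through \<open>x\<close>, \<open>y\<close> and \<open>k\<close>; then
    \<open>|R| <= U <= 3\<close> bounds \<open>k\<close> on both sides.\<close>
  obtain k where k: "a = 2 * k" using assms(4) by (elim evenE)
  have R: "R = x + y - 2 * k" using assms(3) k by simp
  have U: "U = \<bar>x\<bar> + \<bar>y\<bar> - 2 * (x + y) + 2 * k" using assms(5) unfolding R by simp
  have "x + y - 2 * k \<le> U" "2 * k - (x + y) \<le> U" using assms(6) R by auto
  with assms(7) show ?thesis using assms(1,2) unfolding k U by (elim disjE; simp; presburger)
qed

lemma half_local_analysis:
  fixes a :: int
  assumes v: "x1 = -1 \<or> x1 = 0 \<or> x1 = 1" "x2 = -1 \<or> x2 = 0 \<or> x2 = 1" "x3 = -1 \<or> x3 = 0 \<or> x3 = 1"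
    and a: "a = x1 + x2 - R1" "a = x1 + x3 - R2" "a = x2 + x3 - R3" "even a"
    and U: "\<bar>x1\<bar> + \<bar>x2\<bar> - U1 = x1 + x2 + R1"
      "\<bar>x1\<bar> + \<bar>x3\<bar> - U2 = x1 + x3 + R2"
      "\<bar>x2\<bar> + \<bar>x3\<bar> - U3 = x2 + x3 + R3"
    and i: "\<bar>R1\<bar> \<le> U1" "\<bar>R2\<bar> \<le> U2" "\<bar>R3\<bar> \<le> U3" "U1 \<le> 3" "U2 \<le> 3" "U3 \<le> 3"
  shows "a = -4 \<and> x1 + x2 + x3 = -3 \<and> \<bar>x1\<bar> + \<bar>x2\<bar> + \<bar>x3\<bar> = 3 \<or>
    a = 0 \<and> x1 + x2 + x3 \<in> {-1..0} \<and> \<bar>x1\<bar> + \<bar>x2\<bar> + \<bar>x3\<bar> = -(x1 + x2 + x3) \<or>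
    a = 2 \<and> x1 + x2 + x3 \<in> {0..3} \<and> \<bar>x1\<bar> + \<bar>x2\<bar> + \<bar>x3\<bar> = x1 + x2 + x3 \<or>
    a = 4 \<and> x1 + x2 + x3 \<in> {2..3} \<and> \<bar>x1\<bar> + \<bar>x2\<bar> + \<bar>x3\<bar> = x1 + x2 + x3"
proof -
  \<comment> \<open>The three pairs share one \<open>a\<close>. In particular \<open>a = -2\<close>
    dies here: all pair sums would be \<open>-1\<close>, but their total is
    \<open>2 * (x1 + x2 + x3)\<close>.\<close>
  note p = pair_local_analysis[OF v(1) v(2) a(1) a(4) U(1) i(1) i(4)]
    pair_local_analysis[OF v(1) v(3) a(2) a(4) U(2) i(2) i(5)]
    pair_local_analysis[OF v(2) v(3) a(3) a(4) U(3) i(3) i(6)]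
  from v show ?thesis by (elim disjE) (use p in auto)
qed

lemma local_analysis:
  fixes a b :: int
  assumes v: "x1 = -1 \<or> x1 = 0 \<or> x1 = 1" "x2 = -1 \<or> x2 = 0 \<or> x2 = 1" "x3 = -1 \<or> x3 = 0 \<or> x3 = 1"
     "y1 = -1 \<or> y1 = 0 \<or> y1 = 1" "y2 = -1 \<or> y2 = 0 \<or> y2 = 1" "y3 = -1 \<or> y3 = 0 \<or> y3 = 1"
   and a: "a = x1 + x2 - R1" "a = x1 + x3 - R2" "a = x2 + x3 - R3"
   and b: "b = T1 - (y1 + y2)" "b = T2 - (y1 + y3)" "b = T3 - (y2 + y3)"
   and U: "\<bar>x1\<bar> + \<bar>x2\<bar> - U1 = x1 + x2 + R1"
      "\<bar>x1\<bar> + \<bar>x3\<bar> - U2 = x1 + x3 + R2"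
      "\<bar>x2\<bar> + \<bar>x3\<bar> - U3 = x2 + x3 + R3"
   and V: "V1 - (\<bar>y1\<bar> + \<bar>y2\<bar>) = y1 + y2 + T1"
      "V2 - (\<bar>y1\<bar> + \<bar>y3\<bar>) = y1 + y3 + T2"
      "V3 - (\<bar>y2\<bar> + \<bar>y3\<bar>) = y2 + y3 + T3"
   and s: "R1 + R2 + R3 = T1 + T2 + T3" "U1 + U2 + U3 = V1 + V2 + V3"
   and i: "\<bar>R1\<bar> \<le> U1" "\<bar>R2\<bar> \<le> U2" "\<bar>R3\<bar> \<le> U3" "U1 \<le> 3" "U2 \<le> 3" "U3 \<le> 3"
   and j: "\<bar>T1\<bar> \<le> V1" "\<bar>T2\<bar> \<le> V2" "\<bar>T3\<bar> \<le> V3" "V1 \<le> 3" "V2 \<le> 3" "V3 \<le> 3"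
   and ab: "a \<ge> b"
  shows "a = 2 \<and> b = 2 \<and> x1 = 1 \<and> x2 = 1 \<and> x3 = 1 \<and> y1 = -1 \<and> y2 = -1 \<and> y3 = -1 \<or>
    a = 4 \<and> b = -4 \<and> x1 = 1 \<and> x2 = 1 \<and> x3 = 1 \<and> y1 = 1 \<and> y2 = 1 \<and> y3 = 1 \<or>
    a = 0 \<and> b = 0 \<and> x1 = 0 \<and> x2 = 0 \<and> x3 = 0 \<and> U1 = 0 \<and> U2 = 0 \<and> U3 = 0 \<or>
    a = 2 \<and> b = 0 \<and> x1 = 1 \<and> x2 = 1 \<and> x3 = 1 \<or>
    a = 2 \<and> b = -4 \<and> x1 = 0 \<and> x2 = 0 \<and> x3 = 0 \<and> y1 = 1 \<and> y2 = 1 \<and> y3 = 1"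
proof -
  define X Y X' Y' where "X = x1 + x2 + x3" and "Y = y1 + y2 + y3"
    and "X' = \<bar>x1\<bar> + \<bar>x2\<bar> + \<bar>x3\<bar>" and "Y' = \<bar>y1\<bar> + \<bar>y2\<bar> + \<bar>y3\<bar>"
  note defs = X_def Y_def X'_def Y'_def
  \<comment> \<open>Adding the three equations of each kind eliminates \<open>R\<close> and
    \<open>T\<close>, because row sums and column sums of one block have the same total. Fact
    \<open>2\<close> does this for absolute values.\<close>
  have 1: "2 * X - 3 * a = 3 * b + 2 * Y" using s a b by (simp add: defs)
  have "U1 + U2 + U3 = 2 * X' - 4 * X + 3 * a" using U a unfolding defs by (simp add: algebra_simps)
  moreover have "V1 + V2 + V3 = 2 * Y' + 4 * Y + 3 * b" using V b unfolding defs by (simp add: algebra_simps)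
  ultimately have 2: "2 * X' - 4 * X + 3 * a = 2 * Y' + 4 * Y + 3 * b" using s by simp
  have 3: "3 * a = 3 * X + Y + Y' - X'" "3 * b = X' - X - 3 * Y - Y'" using 1 2 by auto
  have par: "even (X' - X)" "even (Y' - Y)" unfolding defs by presburger+
  \<comment> \<open>Since an integer and its absolute value have the same parity,
    \<open>3 * a\<close> and \<open>3 * b\<close> are even.\<close>
  have "even a" "even b" using 3 par by presburger+
  \<comment> \<open>Negation exchanges positive and negative neighbours, so the \<open>y\<close> part is the \<open>x\<close> part for \<open>-M\<close>.\<close>
  note hx = half_local_analysis[OF v(1-3) a this(1) U i]
  have n: "-y1 = -1 \<or> -y1 = 0 \<or> -y1 = 1" "-y2 = -1 \<or> -y2 = 0 \<or> -y2 = 1"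
    "-y3 = -1 \<or> -y3 = 0 \<or> -y3 = 1" using v(4) v(5) v(6) by linarith+
  have nT: "b = -y1 + -y2 - -T1" "b = -y1 + -y3 - -T2" "b = -y2 + -y3 - -T3" using b by simp_all
  have nV: "\<bar>-y1\<bar> + \<bar>-y2\<bar> - V1 = -y1 + -y2 + -T1" "\<bar>-y1\<bar> + \<bar>-y3\<bar> - V2 = -y1 + -y3 + -T2"
    "\<bar>-y2\<bar> + \<bar>-y3\<bar> - V3 = -y2 + -y3 + -T3" unfolding abs_minus_cancel
    by (use V(1) in linarith, use V(2) in linarith, use V(3) in linarith)
  have nj: "\<bar>-T1\<bar> \<le> V1" "\<bar>-T2\<bar> \<le> V2" "\<bar>-T3\<bar> \<le> V3" using j by simp_all
  note hy = half_local_analysis[OF n nT \<open>even b\<close> nV nj j(4-6)]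
  have "a = 2 \<and> b = 2 \<and> X = 3 \<and> Y = -3 \<or> a = 4 \<and> b = -4 \<and> X = 3 \<and> Y = 3 \<or>
    a = 0 \<and> b = 0 \<and> X = 0 \<and> X' = 0 \<or> a = 2 \<and> b = 0 \<and> X = 3 \<or>
    a = 2 \<and> b = -4 \<and> X = 0 \<and> X' = 0 \<and> Y = 3"
  proof -
    have x: "a = -4 \<and> X = -3 \<and> X' = 3 \<or> a = 0 \<and> X \<in> {-1..0} \<and> X' = -X \<or>
      a = 2 \<and> X \<in> {0..3} \<and> X' = X \<or> a = 4 \<and> X \<in> {2..3} \<and> X' = X"
      using hx unfolding defs by simp
    have y: "b = -4 \<and> Y = 3 \<and> Y' = 3 \<or> b = 0 \<and> Y \<in> {0..1} \<and> Y' = Y \<or>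
      b = 2 \<and> Y \<in> {-3..0} \<and> Y' = -Y \<or> b = 4 \<and> Y \<in> {-3..-2} \<and> Y' = -Y"
      using hy unfolding Y_def Y'_def abs_minus_cancel by (elim disjE) simp_all
    show ?thesis using x y 1 2 ab by (elim disjE) auto
  qed
  moreover have "x1 = 1 \<and> x2 = 1 \<and> x3 = 1" if "X = 3" using v(1-3) that unfolding defs by auto
  moreover have "y1 = 1 \<and> y2 = 1 \<and> y3 = 1" if "Y = 3" using v(4-6) that unfolding defs by auto
  moreover have "y1 = -1 \<and> y2 = -1 \<and> y3 = -1" if "Y = -3" using v(4-6) that unfolding defs by auto
  moreover have z: "x1 = 0 \<and> x2 = 0 \<and> x3 = 0" if "X' = 0" using that unfolding defs by arith
  moreover have "U1 = 0 \<and> U2 = 0 \<and> U3 = 0" if "X' = 0" "a = 0"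
    using z[OF that(1)] U a that(2) by simp
  ultimately show ?thesis by (elim disjE) simp_all
qed

section \<open>Partitions into cliques and the two model matrices\<close>

text \<open>The clique hypothesis is transitivity up to equality, so the reflexive closure of
  \<open>R\<close> is an equivalence. A class is a vertex with its three neighbours, and the classes
  partition the vertex set.\<close>

lemma clique_classes:
  fixes R :: "'v::finite \<Rightarrow> 'v \<Rightarrow> bool"
  assumes "symp R" "irreflp R" and card3: "\<And>v. card {w. R v w} = 3"
    and clique: "\<And>u v w. R v u \<Longrightarrow> R v w \<Longrightarrow> u \<noteq> w \<Longrightarrow> R u w"
  defines "E \<equiv> {(u, v). u = v \<or> R u v}"
  shows "equiv UNIV E" and "\<And>v. card (E `` {v}) = 4" and "CARD('v) = 4 * card (UNIV // E)"
proof -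
  show eq: "equiv UNIV E"
  proof (rule equivI)
    show "sym E" using assms(1) by (auto simp: E_def sym_def symp_def)
    show "trans E" using clique assms(1) unfolding E_def trans_def symp_def by blast
  qed (auto simp: E_def refl_on_def)
  have cls: "E `` {v} = insert v {w. R v w}" for v by (auto simp: E_def)
  show card4: "card (E `` {v}) = 4" for v
    using card3 assms(2) unfolding cls by (simp add: irreflp_def)
  have "CARD('v) = card (\<Union>(UNIV // E))" using Union_quotient[OF eq] by simp
  also have "\<dots> = sum card (UNIV // E)"
    by (rule card_Union_disjoint) (use quotient_disj[OF eq] in \<open>auto simp: pairwise_def disjnt_def\<close>)
  also have "\<dots> = sum (\<lambda>_. 4) (UNIV // E)"
    by (rule sum.cong) (auto simp: quotient_def card4)
  finally show "CARD('v) = 4 * card (UNIV // E)" by simp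
qed

lemma inj_card_eq_imp_bij:
  fixes f :: "'a::finite \<Rightarrow> 'b::finite"
  assumes "inj f" "CARD('a) = CARD('b)"
  shows "bij f"
proof -
  have "card (range f) = CARD('b)" using assms by (simp add: card_image)
  then have "range f = UNIV" by (intro card_subset_eq) auto
  then show ?thesis using assms(1) by (simp add: bij_def)
qed

text \<open>The Kronecker difference of \<open>I\<close> by \<open>J\<close> and \<open>J\<close> by
  \<open>I\<close>, with \<open>J\<close> all-one. On the diagonal the two indicators cancel, so
  that no separate case arises.\<close>

fun K4_grid :: "4 \<times> 4 \<Rightarrow> 4 \<times> 4 \<Rightarrow> int" where
  "K4_grid (i, j) (i', j') = of_bool (i = i') - of_bool (j = j')"

text \<open>The block matrix with \<open>J - I\<close> in the diagonal blocks and its negative in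
  the other two.\<close>

fun K4_double :: "4 + 4 \<Rightarrow> 4 + 4 \<Rightarrow> int" where
  "K4_double (Inl i) (Inl j) = of_bool (i \<noteq> j)"
| "K4_double (Inr i) (Inr j) = of_bool (i \<noteq> j)"
| "K4_double (Inl i) (Inr j) = - of_bool (i \<noteq> j)"
| "K4_double (Inr i) (Inl j) = - of_bool (i \<noteq> j)"

section \<open>Global identities for the signed adjacency matrix\<close>

text \<open>\<open>square\<close> speaks of distinct vertices only; the diagonal entry 6 of the
  square comes from the degrees, in \<open>abs_square\<close>.\<close>

locale balanced_srsg =
  fixes M :: "'v::finite \<Rightarrow> 'v \<Rightarrow> int" and a b c :: int
  assumes sym: "M u v = M v u"
    and diag: "M u u = 0"
    and vals: "M u v = -1 \<or> M u v = 0 \<or> M u v = 1"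
    and pos3: "card {v. M u v = 1} = 3"
    and neg3: "card {v. M u v = -1} = 3"
    and square: "u \<noteq> v \<Longrightarrow> (\<Sum>w\<in>UNIV. M u w * M w v) =
      (if M u v = 1 then a else if M u v = -1 then b else c)"
begin

lemma neighbours:
  obtains p1 p2 p3 q1 q2 q3 where
    "{w. M v w = 1} = {p1, p2, p3}" "distinct [p1, p2, p3]"
    "{w. M v w = -1} = {q1, q2, q3}" "distinct [q1, q2, q3]"
proof -
  obtain p1 p2 p3 where "{w. M v w = 1} = {p1, p2, p3}" "distinct [p1, p2, p3]"
    using pos3[of v] unfolding card_3_iff by auto
  moreover obtain q1 q2 q3 where "{w. M v w = -1} = {q1, q2, q3}" "distinct [q1, q2, q3]"
    using neg3[of v] unfolding card_3_iff by auto
  ultimately show ?thesis by (rule that)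
qed

lemma sum_signed:
  "(\<Sum>w\<in>UNIV. M v w * f w) = sum f {w. M v w = 1} - sum f {w. M v w = -1}"
proof -
  have "(\<Sum>w\<in>UNIV. M v w * f w) =
      (\<Sum>w\<in>UNIV. (if M v w = 1 then f w else 0) - (if M v w = -1 then f w else 0))"
    using vals by (intro sum.cong) force+
  then show ?thesis by (simp add: sum_subtractf sum.If_cases)
qed

lemma sum_unsigned:
  "(\<Sum>w\<in>UNIV. \<bar>M v w\<bar> * f w) = sum f {w. M v w = 1} + sum f {w. M v w = -1}"
proof -
  have "(\<Sum>w\<in>UNIV. \<bar>M v w\<bar> * f w) =
      (\<Sum>w\<in>UNIV. (if M v w = 1 then f w else 0) + (if M v w = -1 then f w else 0))"
    using vals by (intro sum.cong) force+
  then show ?thesis by (simp add: sum.distrib sum.If_cases)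
qed

lemma row_sum: "(\<Sum>w\<in>UNIV. M v w) = 0"
  using sum_signed[of v "\<lambda>_. 1"] pos3 neg3 by simp

lemma col_sum: "(\<Sum>w\<in>UNIV. M w v) = 0"
  using row_sum[of v] sym by simp

lemma abs_row_sum: "(\<Sum>w\<in>UNIV. \<bar>M v w\<bar>) = 6"
  using sum_unsigned[of v "\<lambda>_. 1"] pos3 neg3 by simp

lemma abs_square: "(\<Sum>w\<in>UNIV. M v w * M w v) = 6"
proof -
  have "(\<Sum>w\<in>UNIV. M v w * M w v) = (\<Sum>w\<in>UNIV. \<bar>M v w\<bar>)"
  proof (rule sum.cong)
    fix w show "M v w * M w v = \<bar>M v w\<bar>" using vals[of v w] sym[of w v] by auto
  qed simp
  then show ?thesis using abs_row_sum by simp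
qed

text \<open>The square as a combination of \<open>I\<close>, \<open>|M|\<close>, \<open>M\<close>
  and \<open>J\<close>. The coefficients of \<open>|M|\<close> and \<open>M\<close> are
  \<open>(a + b) / 2 - c\<close> and \<open>(a - b) / 2\<close>; doubling keeps them
  integral.\<close>

lemma square_expand:
  "2 * (\<Sum>w\<in>UNIV. M u w * M w v) =
    (if u = v then 12 - 2 * c else 0) + (a + b - 2 * c) * \<bar>M u v\<bar> + (a - b) * M u v + 2 * c"
  using square[of u v] abs_square diag[of v] vals[of u v] by (cases "u = v") auto

lemma even_order: "even CARD('v)"
proof -
  have "even (\<Sum>u\<in>UNIV. \<Sum>v\<in>UNIV. if M u v = 1 then 1 else (0::int))"
    using sym diag by (intro even_sum_symmetric) auto
  then show ?thesis by (simp add: sum.If_cases pos3)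
qed

lemma card_adjacent: "card {w. M v w \<noteq> 0} = 6"
proof -
  have "{w. M v w \<noteq> 0} = {w. M v w = 1} \<union> {w. M v w = -1}" using vals by force
  then show ?thesis using pos3 neg3 by (simp add: card_Un_disjoint disjoint_iff)
qed

text \<open>A vertex and its six neighbours make seven, and parity excludes equality.\<close>

lemma order_ge_8: "CARD('v) \<ge> 8"
proof -
  fix v :: 'v
  have "card (insert v {w. M v w \<noteq> 0}) = 7" using card_adjacent diag by simp
  then have "CARD('v) \<ge> 7" by (metis card_mono finite subset_UNIV)
  then show ?thesis using even_order by presburger
qed

text \<open>A row of the square sums to 0 because \<open>M\<close> kills the all-one vector; the
  same row holds 6 once, \<open>a\<close> and \<open>b\<close> three times each, and
  \<open>c\<close> at the remaining \<open>n - 7\<close> places.\<close>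

lemma parameter_equation: "6 + 3 * (a + b) + c * (int CARD('v) - 7) = 0"
proof -
  fix u :: 'v
  have "(\<Sum>v\<in>UNIV. \<Sum>w\<in>UNIV. M u w * M w v) = 0"
    by (subst sum.swap) (simp add: sum_distrib_left[symmetric] row_sum)
  then have "0 = (\<Sum>v\<in>UNIV. 2 * (\<Sum>w\<in>UNIV. M u w * M w v))"
    by (simp add: sum_distrib_left[symmetric])
  also have "\<dots> = 12 - 2 * c + (a + b - 2 * c) * 6 + 2 * c * int CARD('v)"
    by (simp add: square_expand sum.distrib sum_distrib_left[symmetric] abs_row_sum row_sum)
  finally show ?thesis by (simp add: algebra_simps)
qed

text \<open>\<open>M\<close> commutes with its square. After \<open>square_expand\<close> the terms
  from \<open>I\<close>, \<open>M\<close> and \<open>J\<close> agree on both sides, the last by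
  vanishing, so a multiple of \<open>|M|\<close> commutes with \<open>M\<close>; it remains to
  cancel the factor.\<close>

lemma abs_commute:
  "(\<Sum>w\<in>UNIV. M u w * \<bar>M w v\<bar>) = (\<Sum>w\<in>UNIV. \<bar>M u w\<bar> * M w v)"
proof -
  let ?S = "\<lambda>u v. \<Sum>w\<in>UNIV. M u w * M w v"
  \<comment> \<open>With \<open>a + b = 2 * c\<close> the parameter equation becomes
    \<open>c * (n - 1) = -6\<close>, impossible for \<open>n - 1 >= 7\<close>.\<close>
  have neq: "a + b \<noteq> 2 * c"
  proof
    assume "a + b = 2 * c"
    with parameter_equation have *: "c * (int CARD('v) - 1) = -6" by (simp add: algebra_simps)
    then have "int CARD('v) - 1 dvd -6" by (metis dvd_triv_right)
    then show False using order_ge_8 zdvd_imp_le[of "int CARD('v) - 1" 6] by simp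
  qed
  have swap: "(\<Sum>w\<in>UNIV. M u w * (2 * ?S w v)) = (\<Sum>w\<in>UNIV. (2 * ?S u w) * M w v)"
    by (simp add: sum_distrib_left sum_distrib_right, subst sum.swap) (simp add: mult_ac)
  have "(\<Sum>w\<in>UNIV. M u w * (2 * ?S w v)) =
      (\<Sum>w\<in>UNIV. (if w = v then (12 - 2 * c) * M u w else 0) +
        (a + b - 2 * c) * (M u w * \<bar>M w v\<bar>) + (a - b) * (M u w * M w v) + 2 * c * M u w)"
    unfolding square_expand by (intro sum.cong refl) (auto simp: algebra_simps)
  also have "\<dots> = (12 - 2 * c) * M u v + (a + b - 2 * c) * (\<Sum>w\<in>UNIV. M u w * \<bar>M w v\<bar>) +
      (a - b) * ?S u v"
    by (simp add: sum.distrib sum_distrib_left[symmetric] row_sum)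
  finally have left: "(\<Sum>w\<in>UNIV. M u w * (2 * ?S w v)) = \<dots>" .
  have "(\<Sum>w\<in>UNIV. (2 * ?S u w) * M w v) =
      (\<Sum>w\<in>UNIV. (if u = w then (12 - 2 * c) * M w v else 0) +
        (a + b - 2 * c) * (\<bar>M u w\<bar> * M w v) + (a - b) * (M u w * M w v) + 2 * c * M w v)"
    unfolding square_expand by (intro sum.cong refl) (auto simp: algebra_simps)
  also have "\<dots> = (12 - 2 * c) * M u v + (a + b - 2 * c) * (\<Sum>w\<in>UNIV. \<bar>M u w\<bar> * M w v) +
      (a - b) * ?S u v"
    by (simp add: sum.distrib sum_distrib_left[symmetric] col_sum)
  finally have "(a + b - 2 * c) * (\<Sum>w\<in>UNIV. \<bar>M u w\<bar> * M w v) =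
      (a + b - 2 * c) * (\<Sum>w\<in>UNIV. M u w * \<bar>M w v\<bar>)"
    using left swap by simp
  then show ?thesis using neq by simp
qed

text \<open>As \<open>n > 7\<close>, some pair is non-adjacent; its entry \<open>c\<close> has at
  most six nonzero summands, each of absolute value 1.\<close>

lemma bound_c: "\<bar>c\<bar> \<le> 6"
proof -
  fix u :: 'v
  have "card (insert u {w. M u w \<noteq> 0}) = 7" using card_adjacent diag by simp
  then have "insert u {w. M u w \<noteq> 0} \<noteq> UNIV" using order_ge_8 by force
  then obtain v where v: "u \<noteq> v" "M u v = 0" by (force simp: set_eq_iff)
  have "\<bar>c\<bar> = \<bar>\<Sum>w\<in>UNIV. M u w * M w v\<bar>" using square[of u v] v by simp
  also have "\<dots> \<le> (\<Sum>w\<in>UNIV. \<bar>M u w * M w v\<bar>)" by (rule sum_abs)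
  also have "\<dots> \<le> (\<Sum>w\<in>UNIV. \<bar>M u w\<bar>)"
  proof (rule sum_mono)
    fix w show "\<bar>M u w * M w v\<bar> \<le> \<bar>M u w\<bar>" using vals[of w v] by auto
  qed
  finally show ?thesis using abs_row_sum by simp
qed

section \<open>The neighbourhood of a vertex\<close>

text \<open>The entries of \<open>square\<close> and \<open>abs_commute\<close> between
  \<open>v\<close> and its six neighbours are the equations of \<open>local_analysis\<close>. The
  five alternatives have different pairs \<open>(a, b)\<close>, so the same one occurs at every
  vertex.\<close>

lemma local_structure:
  assumes "a \<ge> b"
  obtains
    (grid) "a = 2" "b = 2" "\<And>u w. M v u = 1 \<Longrightarrow> M v w = 1 \<Longrightarrow> u \<noteq> w \<Longrightarrow> M u w = 1"
      "\<And>u w. M v u = -1 \<Longrightarrow> M v w = -1 \<Longrightarrow> u \<noteq> w \<Longrightarrow> M u w = -1"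
  | (double) "a = 4" "b = -4" "\<And>u w. M v u = 1 \<Longrightarrow> M v w = 1 \<Longrightarrow> u \<noteq> w \<Longrightarrow> M u w = 1"
  | (triangle_free) "a = 0" "b = 0" "\<And>u w. M v u = 1 \<Longrightarrow> M v w \<noteq> 0 \<Longrightarrow> M u w = 0"
  | (cliques) "a = 2" "b = 0" "\<And>u w. M v u = 1 \<Longrightarrow> M v w = 1 \<Longrightarrow> u \<noteq> w \<Longrightarrow> M u w = 1"
  | (mixed) "a = 2" "b = -4" "\<And>u w. M v u = 1 \<Longrightarrow> M v w = 1 \<Longrightarrow> M u w = 0"
      "\<And>u w. M v u = -1 \<Longrightarrow> M v w = -1 \<Longrightarrow> u \<noteq> w \<Longrightarrow> M u w = 1"
proof -
  obtain p1 p2 p3 q1 q2 q3 where P: "{w. M v w = 1} = {p1, p2, p3}" and dP: "distinct [p1, p2, p3]"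
    and Q: "{w. M v w = -1} = {q1, q2, q3}" and dQ: "distinct [q1, q2, q3]"
    by (rule neighbours)
  have mP: "M v p1 = 1" "M v p2 = 1" "M v p3 = 1" using P by auto
  have mQ: "M v q1 = -1" "M v q2 = -1" "M v q3 = -1" using Q by auto
  have ne: "v \<noteq> p1" "v \<noteq> p2" "v \<noteq> p3" "v \<noteq> q1" "v \<noteq> q2" "v \<noteq> q3"
    using mP mQ diag[of v] by auto
  have sums: "sum f {p1, p2, p3} = f p1 + f p2 + f p3" "sum f {q1, q2, q3} = f q1 + f q2 + f q3"
    for f :: "'v \<Rightarrow> int" using dP dQ by auto
  \<comment> \<open>Row \<open>v\<close> is supported on the six neighbours, so each entry of a
    product in this row becomes a signed sum of six entries.\<close>
  note sq = square[where u = v, unfolded sum_signed P Q sums]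
  note ac = abs_commute[of v, unfolded sum_signed sum_unsigned P Q sums]
  have sy: "M p2 p1 = M p1 p2" "M p3 p1 = M p1 p3" "M p3 p2 = M p2 p3"
    "M q2 q1 = M q1 q2" "M q3 q1 = M q1 q3" "M q3 q2 = M q2 q3"
    "M q1 p1 = M p1 q1" "M q1 p2 = M p2 q1" "M q1 p3 = M p3 q1"
    "M q2 p1 = M p1 q2" "M q2 p2 = M p2 q2" "M q2 p3 = M p3 q2"
    "M q3 p1 = M p1 q3" "M q3 p2 = M p2 q3" "M q3 p3 = M p3 q3"
    by (rule sym)+
  have le1: "\<bar>M x y\<bar> \<le> 1" for x y using vals[of x y] by auto
  have tri: "\<bar>x + y + z\<bar> \<le> \<bar>x\<bar> + \<bar>y\<bar> + \<bar>z\<bar>" for x y z :: int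
    by (rule order_trans[OF abs_triangle_ineq add_right_mono[OF abs_triangle_ineq]])
  have le3: "\<bar>M x y\<bar> + \<bar>M x' y'\<bar> + \<bar>M x'' y''\<bar> \<le> 3" for x y x' y' x'' y''
    using add_mono[OF add_mono[OF le1[of x y] le1[of x' y']] le1[of x'' y'']] by simp
  let ?x1 = "M p1 p2" let ?x2 = "M p1 p3" let ?x3 = "M p2 p3"
  let ?y1 = "M q1 q2" let ?y2 = "M q1 q3" let ?y3 = "M q2 q3"
  let ?R = "\<lambda>p. M p q1 + M p q2 + M p q3" let ?U = "\<lambda>p. \<bar>M p q1\<bar> + \<bar>M p q2\<bar> + \<bar>M p q3\<bar>"
  let ?T = "\<lambda>q. M p1 q + M p2 q + M p3 q" let ?V = "\<lambda>q. \<bar>M p1 q\<bar> + \<bar>M p2 q\<bar> + \<bar>M p3 q\<bar>"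
  have A: "a = ?x1 + ?x2 - ?R p1" "a = ?x1 + ?x3 - ?R p2" "a = ?x2 + ?x3 - ?R p3"
    using sq[OF ne(1)] sq[OF ne(2)] sq[OF ne(3)] unfolding mP sy diag by simp_all
  have B: "b = ?T q1 - (?y1 + ?y2)" "b = ?T q2 - (?y1 + ?y3)" "b = ?T q3 - (?y2 + ?y3)"
    using sq[OF ne(4)] sq[OF ne(5)] sq[OF ne(6)] unfolding mQ sy diag by simp_all
  have CA: "\<bar>?x1\<bar> + \<bar>?x2\<bar> - ?U p1 = ?x1 + ?x2 + ?R p1" "\<bar>?x1\<bar> + \<bar>?x3\<bar> - ?U p2 = ?x1 + ?x3 + ?R p2"
     "\<bar>?x2\<bar> + \<bar>?x3\<bar> - ?U p3 = ?x2 + ?x3 + ?R p3"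
    using ac[of p1] ac[of p2] ac[of p3] unfolding sy diag abs_zero add_0_left add_0_right
    by (simp_all only: add_ac)
  have CB: "?V q1 - (\<bar>?y1\<bar> + \<bar>?y2\<bar>) = ?y1 + ?y2 + ?T q1" "?V q2 - (\<bar>?y1\<bar> + \<bar>?y3\<bar>) = ?y1 + ?y3 + ?T q2"
     "?V q3 - (\<bar>?y2\<bar> + \<bar>?y3\<bar>) = ?y2 + ?y3 + ?T q3"
    using ac[of q1] ac[of q2] ac[of q3] unfolding sy diag abs_zero add_0_left add_0_right
    by (simp_all only: add_ac)
  have S: "?R p1 + ?R p2 + ?R p3 = ?T q1 + ?T q2 + ?T q3" "?U p1 + ?U p2 + ?U p3 = ?V q1 + ?V q2 + ?V q3"
    by (simp_all only: add_ac)
  note L = local_analysis[OF vals vals vals vals vals vals A B CA CB S tri tri tri le3 le3 le3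
      tri tri tri le3 le3 le3 assms]
  have inP: "M v u = 1 \<longleftrightarrow> u = p1 \<or> u = p2 \<or> u = p3" for u using P by auto
  have inQ: "M v u = -1 \<longleftrightarrow> u = q1 \<or> u = q2 \<or> u = q3" for u using Q by auto
  have PP: "M u w = t" if "?x1 = t" "?x2 = t" "?x3 = t" "M v u = 1" "M v w = 1" "u \<noteq> w" for u w t
    using that(4-6) unfolding inP by (elim disjE) (simp_all add: sy that(1-3))
  have QQ: "M u w = t" if "?y1 = t" "?y2 = t" "?y3 = t" "M v u = -1" "M v w = -1" "u \<noteq> w" for u w t
    using that(4-6) unfolding inQ by (elim disjE) (simp_all add: sy that(1-3))
  have PQ: "M u w = 0" if "?U p1 = 0" "?U p2 = 0" "?U p3 = 0" "M v u = 1" "M v w = -1" for u w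
  proof -
    have "x = 0 \<and> y = 0 \<and> z = 0" if "\<bar>x\<bar> + \<bar>y\<bar> + \<bar>z\<bar> = 0" for x y z :: int
      using that by linarith
    from this[OF that(1)] this[OF that(2)] this[OF that(3)] that(4,5) show ?thesis
      unfolding inP inQ by auto
  qed
  show thesis
  proof -
    consider "a = 2" "b = 2" "?x1 = 1" "?x2 = 1" "?x3 = 1" "?y1 = -1" "?y2 = -1" "?y3 = -1"
      | "a = 4" "b = -4" "?x1 = 1" "?x2 = 1" "?x3 = 1"
      | "a = 0" "b = 0" "?x1 = 0" "?x2 = 0" "?x3 = 0" "?U p1 = 0" "?U p2 = 0" "?U p3 = 0"
      | "a = 2" "b = 0" "?x1 = 1" "?x2 = 1" "?x3 = 1"
      | "a = 2" "b = -4" "?x1 = 0" "?x2 = 0" "?x3 = 0" "?y1 = 1" "?y2 = 1" "?y3 = 1"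
      using L by (elim disjE conjE) (rule that; assumption)+
    then show thesis
    proof cases
      case 1 show ?thesis by (rule grid[OF 1(1,2)]) (erule (2) PP[OF 1(3-5)], erule (2) QQ[OF 1(6-8)])
    next
      case 2 show ?thesis by (rule double[OF 2(1,2)]) (erule (2) PP[OF 2(3-5)])
    next
      case 3
      have zero: "M u w = 0" if "M v u = 1" "M v w \<noteq> 0" for u w
        using PP[OF 3(3-5) that(1)] PQ[OF 3(6-8) that(1)] vals[of v w] that(2) diag[of u] by (cases "u = w") auto
      show ?thesis by (rule triangle_free[OF 3(1,2)]) (erule (1) zero)
    next
      case 4 show ?thesis by (rule cliques[OF 4(1,2)]) (erule (2) PP[OF 4(3-5)])
    next
      case 5
      have zero: "M u w = 0" if "M v u = 1" "M v w = 1" for u w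
        using PP[OF 5(3-5) that] diag[of u] by (cases "u = w") auto
      show ?thesis by (rule mixed[OF 5(1,2)]) (erule (1) zero, erule (2) QQ[OF 5(6-8)])
    qed
  qed
qed

lemma symp_sign: "symp (\<lambda>u v. M u v = s)"
  by (simp add: symp_def sym)

lemma irreflp_sign: "s \<noteq> 0 \<Longrightarrow> irreflp (\<lambda>u v. M u v = s)"
  by (auto simp: irreflp_def diag)

section \<open>Divisibility of the order, and two impossible cases\<close>

lemma order_divides: "int CARD('v) - 7 dvd 6 + 3 * (a + b)"
proof
  show "6 + 3 * (a + b) = (int CARD('v) - 7) * (- c)"
    using parameter_equation by (simp add: algebra_simps)
qed

text \<open>The ends of a positive edge have disjoint neighbourhoods, so \<open>n >= 12\<close>,
  while \<open>n - 7\<close> divides 6. Only 12 and 13 remain; 5 does not divide 6, and 13 is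
  odd.\<close>

lemma not_triangle_free:
  assumes "a = 0" "b = 0"
    and z: "\<And>v u w. M v u = 1 \<Longrightarrow> M v w \<noteq> 0 \<Longrightarrow> M u w = 0"
  shows False
proof -
  fix v :: 'v
  have "{u. M v u = 1} \<noteq> {}" using pos3[of v] by (metis card.empty zero_neq_numeral)
  then obtain p where p: "M v p = 1" by auto
  have "{w. M v w \<noteq> 0} \<inter> {w. M p w \<noteq> 0} = {}" using z[OF p] by blast
  then have "card ({w. M v w \<noteq> 0} \<union> {w. M p w \<noteq> 0}) = 12"
    by (simp add: card_Un_disjoint card_adjacent)
  then have "CARD('v) \<ge> 12" by (metis card_mono finite subset_UNIV)
  moreover have "int CARD('v) - 7 dvd 6" using order_divides assms(1,2) by simp
  then have "int CARD('v) - 7 \<le> 6" by (rule zdvd_imp_le) simp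
  ultimately have "CARD('v) = 12 \<or> CARD('v) = 13" by linarith
  with even_order \<open>int CARD('v) - 7 dvd 6\<close> show False by auto
qed

text \<open>Three negative neighbours of a vertex span a positive triangle, and a positive triangle
  contradicts \<open>p\<close>.\<close>

lemma not_mixed:
  assumes p: "\<And>v u w. M v u = 1 \<Longrightarrow> M v w = 1 \<Longrightarrow> M u w = 0"
    and q: "\<And>v u w. M v u = -1 \<Longrightarrow> M v w = -1 \<Longrightarrow> u \<noteq> w \<Longrightarrow> M u w = 1"
  shows False
proof -
  fix v :: 'v
  obtain p1 p2 p3 q1 q2 q3 where "{w. M v w = -1} = {q1, q2, q3}" "distinct [q1, q2, q3]"
    by (rule neighbours)
  then have "M v q1 = -1" "M v q2 = -1" "M v q3 = -1" "q1 \<noteq> q2" "q1 \<noteq> q3" "q2 \<noteq> q3" by auto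
  then have "M q1 q2 = 1" "M q1 q3 = 1" "M q2 q3 = 1" using q by blast+
  then show False using p[of q1 q2 q3] by simp
qed

section \<open>Positive edges forming disjoint copies of K4\<close>

context
  assumes pos_clique: "\<And>v u w. M v u = 1 \<Longrightarrow> M v w = 1 \<Longrightarrow> u \<noteq> w \<Longrightarrow> M u w = 1"
begin

lemma pos_equiv:
  "equiv UNIV {(u, v). u = v \<or> M u v = 1}"
  "card ({(u, v). u = v \<or> M u v = 1} `` {v}) = 4"
  "CARD('v) = 4 * card (UNIV // {(u, v). u = v \<or> M u v = 1})"
  using clique_classes[of "\<lambda>u v. M u v = 1", OF symp_sign irreflp_sign pos3 pos_clique] by simp_all

lemma four_dvd_order: "4 dvd CARD('v)"
  using pos_equiv(3) by simp

text \<open>Here \<open>n = 4 * k\<close> and \<open>n - 7\<close> divides 12, so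
  \<open>k <= 4\<close>. The values 5 and 9 of \<open>n - 7\<close> fail, and \<open>n = 8\<close>
  would give \<open>c = -12\<close>, against \<open>bound_c\<close>.\<close>

lemma not_cliques:
  assumes "a = 2" "b = 0"
  shows False
proof -
  have e: "c * (int CARD('v) - 7) = -12" using parameter_equation assms by simp
  have "int CARD('v) - 7 dvd 12" using order_divides assms by simp
  moreover from this have "int CARD('v) - 7 \<le> 12" by (rule zdvd_imp_le) simp
  moreover obtain k where "CARD('v) = 4 * k" using four_dvd_order by blast
  ultimately have "k \<le> 4" "k \<ge> 2" "4 * int k - 7 dvd 12" using order_ge_8 by auto
  then have "k = 2" by (cases "k = 3"; cases "k = 4") auto
  then show False using e bound_c \<open>CARD('v) = 4 * k\<close> by simp
qed

text \<open>Among \<open>n = 4 * k\<close> with \<open>n - 7\<close> dividing 18 only 8 and 16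
  survive, and \<open>n = 8\<close> would give \<open>c = -18\<close>, against
  \<open>bound_c\<close>.\<close>

lemma grid_order:
  assumes "a = 2" "b = 2"
  shows "CARD('v) = 16"
proof -
  have e: "c * (int CARD('v) - 7) = -18" using parameter_equation assms by simp
  have "int CARD('v) - 7 dvd 18" using order_divides assms by simp
  moreover from this have "int CARD('v) - 7 \<le> 18" by (rule zdvd_imp_le) simp
  moreover obtain k where k: "CARD('v) = 4 * k" using four_dvd_order by blast
  ultimately have "k \<le> 6" "k \<ge> 2" "4 * int k - 7 dvd 18" using order_ge_8 by auto
  then have "k = 2 \<or> k = 4" by (cases "k = 3"; cases "k = 5"; cases "k = 6") auto
  then show ?thesis using e bound_c k by auto
qed

lemma double_order:
  assumes "a = 4" "b = -4"
  shows "CARD('v) = 8"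
proof -
  have "int CARD('v) - 7 dvd 6" using order_divides assms by simp
  moreover from this have "int CARD('v) - 7 \<le> 6" by (rule zdvd_imp_le) simp
  moreover obtain k where k: "CARD('v) = 4 * k" using four_dvd_order by blast
  ultimately have "k \<le> 3" "k \<ge> 2" "4 * int k - 7 dvd 6" using order_ge_8 by auto
  then show ?thesis using k by (cases "k = 3") auto
qed

text \<open>Both signs partition the 16 vertices into four cliques. A vertex is determined by its
  positive and its negative clique, since distinct vertices sharing both would be joined with both
  signs.\<close>

lemma grid_isomorphism:
  assumes "a = 2" "b = 2"
    and neg_clique: "\<And>v u w. M v u = -1 \<Longrightarrow> M v w = -1 \<Longrightarrow> u \<noteq> w \<Longrightarrow> M u w = -1"
  shows "\<exists>f. bij f \<and> (\<forall>u v. K4_grid (f u) (f v) = M u v)"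
proof -
  define E F where "E = {(u, v). u = v \<or> M u v = 1}" and "F = {(u, v). u = v \<or> M u v = -1}"
  note n = grid_order[OF assms(1,2)]
  have E: "equiv UNIV E" "card (UNIV // E) = 4"
    using pos_equiv(1,3) n unfolding E_def by simp_all
  have F: "equiv UNIV F" "CARD('v) = 4 * card (UNIV // F)"
    using clique_classes[of "\<lambda>u v. M u v = -1", OF symp_sign irreflp_sign neg3 neg_clique]
    unfolding F_def by simp_all
  have cF: "card (UNIV // F) = 4" using F(2) n by simp
  obtain g where g: "bij_betw g (UNIV // E) (UNIV :: 4 set)"
    using finite_same_card_bij[of "UNIV // E" "UNIV :: 4 set"] E(2) by auto
  obtain h where h: "bij_betw h (UNIV // F) (UNIV :: 4 set)"
    using finite_same_card_bij[of "UNIV // F" "UNIV :: 4 set"] cF by auto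
  \<comment> \<open>Positive edges of the grid keep the first coordinate, so this one is the
    positive clique.\<close>
  define f where "f u = (g (E `` {u}), h (F `` {u}))" for u
  have 1: "g (E `` {u}) = g (E `` {v}) \<longleftrightarrow> u = v \<or> M u v = 1" for u v
  proof -
    have "g (E `` {u}) = g (E `` {v}) \<longleftrightarrow> E `` {u} = E `` {v}"
      using bij_betw_imp_inj_on[OF g] by (auto simp: inj_on_def quotient_def)
    then show ?thesis using eq_equiv_class_iff[OF E(1), of u v] by (simp add: E_def)
  qed
  have 2: "h (F `` {u}) = h (F `` {v}) \<longleftrightarrow> u = v \<or> M u v = -1" for u v
  proof -
    have "h (F `` {u}) = h (F `` {v}) \<longleftrightarrow> F `` {u} = F `` {v}"
      using bij_betw_imp_inj_on[OF h] by (auto simp: inj_on_def quotient_def)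
    then show ?thesis using eq_equiv_class_iff[OF F(1), of u v] by (simp add: F_def)
  qed
  have "inj f"
  proof (rule injI)
    fix u v assume "f u = f v"
    then show "u = v" using 1[of u v] 2[of u v] by (auto simp: f_def)
  qed
  then have "bij f"
    using n by (intro inj_card_eq_imp_bij) simp_all
  moreover have "K4_grid (f u) (f v) = M u v" for u v
    using vals[of u v] diag[of u] by (cases "u = v") (auto simp: f_def 1 2)
  ultimately show ?thesis by (intro exI[of _ f]) simp
qed

text \<open>With 8 vertices the positive cliques are \<open>X\<close> and its complement. Each
  vertex has one non-neighbour, which lies in the other half, and its remaining edges across are
  negative.\<close>

lemma double_isomorphism:
  assumes "a = 4" "b = -4"
  shows "\<exists>f. bij f \<and> (\<forall>u v. K4_double (f u) (f v) = M u v)"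
proof -
  note n = double_order[OF assms]
  define E where "E = {(u, v). u = v \<or> M u v = 1}"
  have E: "equiv UNIV E" "card (E `` {v}) = 4" for v
    using pos_equiv(1,2) unfolding E_def by simp_all
  have Em: "w \<in> E `` {u} \<longleftrightarrow> w = u \<or> M u w = 1" for u w by (auto simp: E_def)
  fix v0 :: 'v
  define X where "X = E `` {v0}"
  have cX: "card X = 4" "card (- X) = 4" using E(2) n by (auto simp: X_def Compl_eq_Diff_UNIV card_Diff_subset)
  have same: "M u w = 1" if "u \<noteq> w" "u \<in> X \<longleftrightarrow> w \<in> X" for u w
  proof (cases "u \<in> X")
    case True
    then have "(v0, u) \<in> E" "(v0, w) \<in> E" using that(2) unfolding X_def by auto
    then have "w \<in> E `` {u}" using E(1) by (auto simp: equiv_def dest: symD transD)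
    then show ?thesis using that(1) Em by auto
  next
    case False
    have "E `` {u} \<inter> X = {}"
      using False E(1) unfolding X_def by (auto simp: equiv_def dest: symD transD)
    then have "E `` {u} = - X" using cX(2) E(2)[of u] by (intro card_subset_eq) auto
    then have "w \<in> E `` {u}" using that(2) False by auto
    then show ?thesis using that(1) Em by auto
  qed
  \<comment> \<open>Row \<open>u\<close> has \<open>8 - 6 = 2\<close> zeros, one of them at
    \<open>u\<close> itself.\<close>
  have "\<exists>!w. w \<noteq> u \<and> M u w = 0" for u
  proof -
    have "card (UNIV - {w. M u w \<noteq> 0}) = 2" using card_adjacent[of u] n by (subst card_Diff_subset) simp_all
    moreover have "UNIV - {w. M u w \<noteq> 0} = {w. M u w = 0}" by auto
    ultimately have "card {w. M u w = 0} = 2" by (rule subst[rotated])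
    then obtain x y where S: "{w. M u w = 0} = {x, y}" "x \<noteq> y" by (auto simp: card_2_iff)
    have "u \<in> {x, y}" using diag[of u] unfolding S(1)[symmetric] by simp
    with S obtain z where "{w. M u w = 0} = {u, z}" "z \<noteq> u" by auto
    then have "\<And>w. M u w = 0 \<longleftrightarrow> w = u \<or> w = z" "z \<noteq> u" by auto
    then show ?thesis by (intro ex1I[of _ z]) auto
  qed
  note ex1 = this
  \<comment> \<open>the matching by non-adjacency, pairing \<open>x\<^sub>i\<close> with \<open>y\<^sub>i\<close>\<close>
  define \<pi> where "\<pi> u = (THE w. w \<noteq> u \<and> M u w = 0)" for u
  have \<pi>: "\<pi> u \<noteq> u" "M u (\<pi> u) = 0" for u
    using theI'[OF ex1[of u]] unfolding \<pi>_def by blast+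
  have unique: "\<pi> u = w" if "w \<noteq> u" "M u w = 0" for u w
    unfolding \<pi>_def by (rule the1_equality[OF ex1]) (use that in simp)
  have invol: "\<pi> (\<pi> u) = u" for u
    by (rule unique) (use \<pi>[of u] sym[of u "\<pi> u"] in auto)
  have cross: "\<pi> u \<in> X \<longleftrightarrow> u \<notin> X" for u using same[of u "\<pi> u"] \<pi>[of u] by auto
  have diff: "M u w = - of_bool (w \<noteq> \<pi> u)" if "u \<in> X \<longleftrightarrow> w \<notin> X" for u w
  proof (cases "w = \<pi> u")
    case False
    have "u \<noteq> w" using that by auto
    then have "M u w \<noteq> 0" using unique[of w u] False by auto
    moreover have "M u w \<noteq> 1"
    proof
      assume *: "M u w = 1"
      \<comment> \<open>The half containing \<open>u\<close>. A positive edge across would put a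
        fifth element into the class of \<open>u\<close>.\<close>
      define Y where "Y = (if u \<in> X then X else - X)"
      have Y: "w \<notin> Y" "card Y = 4" using that cX by (auto simp: Y_def)
      have "Y \<subseteq> E `` {u}"
      proof
        fix y assume "y \<in> Y"
        then have "u \<in> X \<longleftrightarrow> y \<in> X" by (auto simp: Y_def split: if_splits)
        then show "y \<in> E `` {u}" unfolding Em using same[of u y] by blast
      qed
      moreover have "w \<in> E `` {u}" unfolding Em using * by simp
      ultimately have "Y \<subset> E `` {u}" using Y(1) by blast
      then have "card Y < card (E `` {u})" by (rule psubset_card_mono[OF finite])
      then show False using E(2) Y(2) by simp
    qed
    ultimately show ?thesis using vals[of u w] False by auto
  qed (simp add: \<pi>)
  obtain h where h: "bij_betw h X (UNIV :: 4 set)"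
    using finite_same_card_bij[of X "UNIV :: 4 set"] cX(1) by auto
  have hi: "h u = h w \<longleftrightarrow> u = w" if "u \<in> X" "w \<in> X" for u w
    using bij_betw_imp_inj_on[OF h] that by (auto simp: inj_on_def)
  \<comment> \<open>A vertex outside \<open>X\<close> inherits the label of its partner, so equal
    labels in different halves mean non-adjacency.\<close>
  define f where "f u = (if u \<in> X then Inl (h u) else Inr (h (\<pi> u)))" for u
  have inj\<pi>: "\<pi> u = \<pi> w \<longleftrightarrow> u = w" for u w using invol by metis
  have eq: "K4_double (f u) (f w) = M u w" for u w
  proof (cases "u = w")
    case True then show ?thesis by (simp add: f_def diag)
  next
    case False
    consider "u \<in> X" "w \<in> X" | "u \<in> X" "w \<notin> X" | "u \<notin> X" "w \<in> X" | "u \<notin> X" "w \<notin> X" by blast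
    then show ?thesis
    proof cases
      case 1 then show ?thesis using same[OF False] hi[of u w] False by (simp add: f_def)
    next
      case 2
      then have "K4_double (f u) (f w) = - of_bool (u \<noteq> \<pi> w)"
        using hi[of u "\<pi> w"] cross[of w] by (simp add: f_def)
      moreover have "u \<noteq> \<pi> w \<longleftrightarrow> w \<noteq> \<pi> u" using invol by metis
      ultimately show ?thesis using diff[of u w] 2 by simp
    next
      case 3
      then have "K4_double (f u) (f w) = - of_bool (\<pi> u \<noteq> w)"
        using hi[of "\<pi> u" w] cross[of u] by (simp add: f_def)
      then show ?thesis using diff[of u w] 3 by (simp add: eq_commute)
    next
      case 4
      then show ?thesis using same[OF False] hi[of "\<pi> u" "\<pi> w"] cross[of u] cross[of w] inj\<pi> False
        by (simp add: f_def)
    qed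
  qed
  have "inj f"
  proof (rule injI)
    fix u w assume "f u = f w"
    then show "u = w"
      using hi[of u w] hi[of "\<pi> u" "\<pi> w"] cross[of u] cross[of w] inj\<pi>
      by (auto simp: f_def split: if_splits)
  qed
  then have "bij f" using n by (intro inj_card_eq_imp_bij) simp_all
  then show ?thesis using eq by (intro exI[of _ f]) simp
qed

end

section \<open>Classification under \<open>a >= b\<close>\<close>

lemma classification:
  assumes "a \<ge> b"
  shows "(\<exists>f. bij f \<and> (\<forall>u v. K4_grid (f u) (f v) = M u v)) \<or>
    (\<exists>f. bij f \<and> (\<forall>u v. K4_double (f u) (f v) = M u v))"
proof -
  \<comment> \<open>Fixing \<open>(a, b)\<close> selects one alternative of
    \<open>local_structure\<close>, which turns its conclusion at one vertex into a statement about
    all vertices.\<close>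
  have pos: "M u w = 1" if "a = 2 \<and> b = 2 \<or> a = 4 \<or> a = 2 \<and> b = 0" "M v u = 1" "M v w = 1" "u \<noteq> w" for u v w
    by (rule local_structure[OF assms, of v]; use that in \<open>linarith | blast\<close>)
  have neg: "M u w = -1" if "a = 2" "b = 2" "M v u = -1" "M v w = -1" "u \<noteq> w" for u v w
    by (rule local_structure[OF assms, of v]; use that in \<open>linarith | blast\<close>)
  have zero: "M u w = 0" if "a = 0" "M v u = 1" "M v w \<noteq> 0" for u v w
    by (rule local_structure[OF assms, of v]; use that in \<open>linarith | blast\<close>)
  have mixed0: "M u w = 0" if "a = 2" "b = -4" "M v u = 1" "M v w = 1" for u v w
    by (rule local_structure[OF assms, of v]; use that in \<open>linarith | blast\<close>)
  have mixed1: "M u w = 1" if "a = 2" "b = -4" "M v u = -1" "M v w = -1" "u \<noteq> w" for u v w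
    by (rule local_structure[OF assms, of v]; use that in \<open>linarith | blast\<close>)
  fix v :: 'v
  consider "a = 2" "b = 2" | "a = 4" "b = -4" | "a = 0" "b = 0" | "a = 2" "b = 0" | "a = 2" "b = -4"
    by (rule local_structure[OF assms, of v])
  then show ?thesis
  proof cases
    case 1
    have pc: "M u w = 1" if "M v u = 1" "M v w = 1" "u \<noteq> w" for u v w by (rule pos) (use 1 that in auto)
    show ?thesis by (rule disjI1[OF grid_isomorphism[OF pc 1 neg[OF 1]]])
  next
    case 2
    have pc: "M u w = 1" if "M v u = 1" "M v w = 1" "u \<noteq> w" for u v w by (rule pos) (use 2 that in auto)
    show ?thesis by (rule disjI2[OF double_isomorphism[OF pc 2]])
  next
    case 3
    show ?thesis by (rule FalseE[OF not_triangle_free[OF 3 zero[OF 3(1)]]])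
  next
    case 4
    have pc: "M u w = 1" if "M v u = 1" "M v w = 1" "u \<noteq> w" for u v w by (rule pos) (use 4 that in auto)
    show ?thesis by (rule FalseE[OF not_cliques[OF pc 4]])
  next
    case 5
    show ?thesis by (rule FalseE[OF not_mixed[OF mixed0[OF 5] mixed1[OF 5]]])
  qed
qed

end

section \<open>Signed graphs as integer matrices\<close>

definition signed_adj :: "'v sgraph \<Rightarrow> 'v \<Rightarrow> 'v \<Rightarrow> int" where
  "signed_adj G u v = (if adjacent G u v then esign G {u, v} else 0)"

lemma adj_matrix_nth: "adj_matrix G $ u $ v = signed_adj G u v"
  by (simp add: adj_matrix_def signed_adj_def)

lemma signed_adj_sym: "signed_adj G u v = signed_adj G v u"
  by (simp add: signed_adj_def adjacent_def insert_commute)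

lemma signed_adj_negation: "signed_adj (negation G) u v = - signed_adj G u v"
  by (simp add: signed_adj_def adjacent_def negation_def)

lemma signed_graph_negation: "signed_graph G \<Longrightarrow> signed_graph (negation G)"
  by (auto simp: signed_graph_def negation_def)

lemma signed_adj_cases:
  assumes "signed_graph G"
  shows "signed_adj G u v = -1 \<or> signed_adj G u v = 0 \<or> signed_adj G u v = 1"
  using assms by (auto simp: signed_graph_def signed_adj_def adjacent_def)

lemma signed_adj_diag:
  assumes "signed_graph G"
  shows "signed_adj G u u = 0"
  using assms by (force simp: signed_graph_def signed_adj_def adjacent_def)

lemma adjacent_iff_signed_adj:
  assumes "signed_graph G"
  shows "adjacent G u v \<longleftrightarrow> signed_adj G u v \<noteq> 0"
  using assms by (force simp: signed_graph_def signed_adj_def adjacent_def)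

lemma esign_signed_adj: "adjacent G u v \<Longrightarrow> esign G {u, v} = signed_adj G u v"
  by (simp add: signed_adj_def)

lemma not_homogeneousI:
  assumes "e \<in> edges G" "e' \<in> edges G" "esign G e \<noteq> esign G e'"
  shows "\<not> homogeneous G" "edges G \<noteq> {}"
  using assms unfolding homogeneous_def by blast+

text \<open>Signs are nonzero, so one entry records both adjacency and sign.\<close>

lemma sg_isomorphic_iff:
  assumes "signed_graph G" "signed_graph H"
  shows "sg_isomorphic G H \<longleftrightarrow>
    (\<exists>f. bij f \<and> (\<forall>u v. signed_adj H (f u) (f v) = signed_adj G u v))"
proof -
  have "(\<forall>u v. adjacent G u v \<longleftrightarrow> adjacent H (f u) (f v)) \<and>
      (\<forall>u v. adjacent G u v \<longrightarrow> esign H {f u, f v} = esign G {u, v}) \<longleftrightarrow>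
      (\<forall>u v. signed_adj H (f u) (f v) = signed_adj G u v)" for f
    using adjacent_iff_signed_adj[OF assms(1)] adjacent_iff_signed_adj[OF assms(2)] esign_signed_adj
    by metis
  then show ?thesis unfolding sg_isomorphic_def by simp
qed

text \<open>An edge at \<open>v\<close> has two elements and corresponds to its other
  endpoint.\<close>

lemma card_incident_edges:
  assumes "signed_graph G"
  shows "card {e \<in> edges G. v \<in> e \<and> P e} = card {u. adjacent G v u \<and> P {v, u}}"
proof (rule sym, rule bij_betw_same_card)
  show "bij_betw (\<lambda>u. {v, u}) {u. adjacent G v u \<and> P {v, u}} {e \<in> edges G. v \<in> e \<and> P e}"
  proof (rule bij_betw_imageI)
    show "inj_on (\<lambda>u. {v, u}) {u. adjacent G v u \<and> P {v, u}}"
      by (auto simp: inj_on_def doubleton_eq_iff)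
    have "\<exists>u. e = {v, u}" if "e \<in> edges G" "v \<in> e" for e
    proof -
      have "card e = 2" using assms that(1) by (auto simp: signed_graph_def)
      then show ?thesis using that(2) by (auto simp: card_2_iff insert_commute)
    qed
    then show "(\<lambda>u. {v, u}) ` {u. adjacent G v u \<and> P {v, u}} = {e \<in> edges G. v \<in> e \<and> P e}"
      by (force simp: adjacent_def)
  qed
qed

lemma degree_signed_adj:
  assumes "signed_graph G"
  shows "pos_degree G v = card {u. signed_adj G v u = 1}"
    and "neg_degree G v = card {u. signed_adj G v u = -1}"
    and "card {e \<in> edges G. v \<in> e} = card {u. signed_adj G v u \<noteq> 0}"
proof -
  show "pos_degree G v = card {u. signed_adj G v u = 1}"
    unfolding pos_degree_def card_incident_edges[OF assms]
    by (rule arg_cong[where f = card]) (auto simp: signed_adj_def)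
  show "neg_degree G v = card {u. signed_adj G v u = -1}"
    unfolding neg_degree_def card_incident_edges[OF assms]
    by (rule arg_cong[where f = card]) (auto simp: signed_adj_def)
  show "card {e \<in> edges G. v \<in> e} = card {u. signed_adj G v u \<noteq> 0}"
    using card_incident_edges[OF assms, of v "\<lambda>_. True"] adjacent_iff_signed_adj[OF assms] by simp
qed

section \<open>Balanced matrices and their invariance\<close>

text \<open>The graph-theoretic side of the classification in matrix terms. Quantifying over
  \<open>a\<close>, \<open>b\<close>, \<open>c\<close> makes it stable under negation, which
  exchanges \<open>a\<close> and \<open>b\<close>.\<close>

definition balanced_matrix :: "('v::finite \<Rightarrow> 'v \<Rightarrow> int) \<Rightarrow> bool" where
  "balanced_matrix M \<longleftrightarrow> (\<forall>u v. (\<lambda>x y. M x y \<noteq> 0)\<^sup>*\<^sup>* u v) \<and>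
     (\<forall>v. card {w. M v w = 1} = 3) \<and> (\<forall>v. card {w. M v w = -1} = 3) \<and>
     (\<exists>a b c. \<forall>u v. u \<noteq> v \<longrightarrow> (\<Sum>w\<in>UNIV. M u w * M w v) =
        (if M u v = 1 then a else if M u v = -1 then b else c))"

lemma square_signed_adj:
  "(adj_matrix G ** adj_matrix G) $ u $ v = (\<Sum>w\<in>UNIV. signed_adj G u w * signed_adj G w v)"
  by (simp add: matrix_matrix_mult_def adj_matrix_nth)

lemma square_entry_eq:
  assumes "signed_graph G"
  shows "(if adjacent G u v then if esign G {u, v} = 1 then a else b else c) =
    (if signed_adj G u v = 1 then a else if signed_adj G u v = -1 then b else (c :: int))"
  using signed_adj_cases[OF assms, of u v] adjacent_iff_signed_adj[OF assms, of u v]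
    esign_signed_adj[of G u v] by auto

text \<open>Degree 6 and net-degree 0 amount to three edges of each sign. A vertex with both signs
  makes the graph neither homogeneous nor edgeless, and its degree supplies
  \<open>r = 6\<close>.\<close>

lemma balanced_srsg_iff:
  assumes "signed_graph G"
  shows "sg_connected G \<and> sg_regular G 6 \<and> strongly_regular G \<and> net_regular G 0 \<longleftrightarrow>
    balanced_matrix (signed_adj G)"
proof -
  let ?M = "signed_adj G"
  have conn: "sg_connected G \<longleftrightarrow> (\<forall>u v. (\<lambda>x y. ?M x y \<noteq> 0)\<^sup>*\<^sup>* u v)"
  proof -
    have "adjacent G = (\<lambda>x y. ?M x y \<noteq> 0)" using adjacent_iff_signed_adj[OF assms] by (intro ext)
    then show ?thesis unfolding sg_connected_def by simp
  qed
  have split: "card {w. ?M v w \<noteq> 0} = card {w. ?M v w = 1} + card {w. ?M v w = -1}" for v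
  proof -
    have "{w. ?M v w \<noteq> 0} = {w. ?M v w = 1} \<union> {w. ?M v w = -1}"
      using signed_adj_cases[OF assms] by force
    then show ?thesis by (simp add: card_Un_disjoint disjoint_iff)
  qed
  have deg: "sg_regular G 6 \<and> net_regular G 0 \<longleftrightarrow>
      (\<forall>v. card {w. ?M v w = 1} = 3) \<and> (\<forall>v. card {w. ?M v w = -1} = 3)"
  proof -
    have "card {w. ?M v w = 1} + card {w. ?M v w = -1} = 6 \<and>
        int (card {w. ?M v w = 1}) - int (card {w. ?M v w = -1}) = 0 \<longleftrightarrow>
        card {w. ?M v w = 1} = 3 \<and> card {w. ?M v w = -1} = 3" for v by linarith
    then show ?thesis
      unfolding sg_regular_def net_regular_def net_degree_def degree_signed_adj[OF assms] split
      by meson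
  qed
  have "strongly_regular G \<longleftrightarrow> (\<exists>a b c. \<forall>u v. u \<noteq> v \<longrightarrow> (\<Sum>w\<in>UNIV. ?M u w * ?M w v) =
        (if ?M u v = 1 then a else if ?M u v = -1 then b else c))"
    if pos: "\<forall>v. card {w. ?M v w = 1} = 3" and neg: "\<forall>v. card {w. ?M v w = -1} = 3"
  proof -
    fix v :: 'a
    have "{w. ?M v w = 1} \<noteq> {}" "{w. ?M v w = -1} \<noteq> {}"
      using pos neg by (metis card.empty zero_neq_numeral)+
    then obtain p q where pq: "?M v p = 1" "?M v q = -1" by auto
    then have ne: "\<not> homogeneous G" "edges G \<noteq> {}"
      using not_homogeneousI[of "{v, p}" G "{v, q}"]
      by (auto simp: signed_adj_def adjacent_def split: if_splits)
    have diag: "(\<Sum>w\<in>UNIV. ?M u w * ?M w u) = int 6" for u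
    proof -
      have "(\<Sum>w\<in>UNIV. ?M u w * ?M w u) = (\<Sum>w\<in>UNIV. if ?M u w \<noteq> 0 then 1 else 0)"
      proof (rule sum.cong)
        fix w show "?M u w * ?M w u = (if ?M u w \<noteq> 0 then 1 else 0)"
          using signed_adj_cases[OF assms, of u w] signed_adj_sym[of G w u] by auto
      qed simp
      then show ?thesis using split pos neg by (simp add: sum.If_cases)
    qed
    show ?thesis
    proof
      assume "strongly_regular G"
      then obtain n r a b c where "srsg_with_params G n r a b c" unfolding strongly_regular_def by blast
      then have "\<forall>u v. u \<noteq> v \<longrightarrow> (\<Sum>w\<in>UNIV. ?M u w * ?M w v) =
          (if ?M u v = 1 then a else if ?M u v = -1 then b else c)"
        unfolding srsg_with_params_def square_signed_adj square_entry_eq[OF assms] by simp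
      then show "\<exists>a b c. \<forall>u v. u \<noteq> v \<longrightarrow> (\<Sum>w\<in>UNIV. ?M u w * ?M w v) =
          (if ?M u v = 1 then a else if ?M u v = -1 then b else c)" by blast
    next
      assume "\<exists>a b c. \<forall>u v. u \<noteq> v \<longrightarrow> (\<Sum>w\<in>UNIV. ?M u w * ?M w v) =
          (if ?M u v = 1 then a else if ?M u v = -1 then b else c)"
      then obtain a b c where *: "\<And>u v. u \<noteq> v \<Longrightarrow> (\<Sum>w\<in>UNIV. ?M u w * ?M w v) =
          (if ?M u v = 1 then a else if ?M u v = -1 then b else c)" by blast
      have "srsg_with_params G CARD('a) 6 a b c"
        unfolding srsg_with_params_def square_signed_adj square_entry_eq[OF assms]
        using assms ne diag * by auto
      then show "strongly_regular G" unfolding strongly_regular_def by blast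
    qed
  qed
  then show ?thesis using conn deg unfolding balanced_matrix_def by blast
qed

lemma balanced_matrix_uminus:
  assumes "balanced_matrix M"
  shows "balanced_matrix (\<lambda>u v. - M u v)"
proof -
  obtain a b c where sq: "\<And>u v. u \<noteq> v \<Longrightarrow> (\<Sum>w\<in>UNIV. M u w * M w v) =
      (if M u v = 1 then a else if M u v = -1 then b else c)"
    using assms unfolding balanced_matrix_def by blast
  have "\<forall>u v. u \<noteq> v \<longrightarrow> (\<Sum>w\<in>UNIV. (- M u w) * (- M w v)) =
      (if - M u v = 1 then b else if - M u v = -1 then a else c)"
    using sq by (auto simp: minus_equation_iff[of _ 1])
  then have "\<exists>a b c. \<forall>u v. u \<noteq> v \<longrightarrow> (\<Sum>w\<in>UNIV. (- M u w) * (- M w v)) =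
      (if - M u v = 1 then a else if - M u v = -1 then b else c)" by blast
  moreover have "{w. - M v w = 1} = {w. M v w = -1}" "{w. - M v w = -1} = {w. M v w = 1}" for v by auto
  ultimately show ?thesis using assms unfolding balanced_matrix_def by auto
qed

lemma balanced_matrix_transfer:
  fixes f :: "'v::finite \<Rightarrow> 'w::finite"
  assumes f: "bij f" and eq: "\<And>u v. N (f u) (f v) = M u v" and "balanced_matrix N"
  shows "balanced_matrix M"
proof -
  obtain a b c where sq: "\<And>u v. u \<noteq> v \<Longrightarrow> (\<Sum>w\<in>UNIV. N u w * N w v) =
      (if N u v = 1 then a else if N u v = -1 then b else c)"
    using assms(3) unfolding balanced_matrix_def by blast
  have "(\<Sum>w\<in>UNIV. M u w * M w v) = (\<Sum>w\<in>UNIV. N (f u) w * N w (f v))" for u v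
    using sum.reindex_bij_betw[OF f, of "\<lambda>w. N (f u) w * N w (f v)"] eq by simp
  moreover have "f u \<noteq> f v" if "u \<noteq> v" for u v using f that by (simp add: bij_def inj_eq)
  ultimately have "\<forall>u v. u \<noteq> v \<longrightarrow> (\<Sum>w\<in>UNIV. M u w * M w v) =
      (if M u v = 1 then a else if M u v = -1 then b else c)"
    using sq eq by simp
  then have square: "\<exists>a b c. \<forall>u v. u \<noteq> v \<longrightarrow> (\<Sum>w\<in>UNIV. M u w * M w v) =
      (if M u v = 1 then a else if M u v = -1 then b else c)" by blast
  have card: "card {w. M v w = s} = card {w. N (f v) w = s}" for v s
  proof (rule bij_betw_same_card[of f])
    have "f ` {w. M v w = s} = {w. N (f v) w = s}"
      using bij_is_surj[OF f] eq by (auto simp: image_iff) (metis surjD)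
    then show "bij_betw f {w. M v w = s} {w. N (f v) w = s}"
      using bij_is_inj[OF f] by (auto simp: bij_betw_def intro: inj_on_subset)
  qed
  have conn: "(\<lambda>x y. M x y \<noteq> 0)\<^sup>*\<^sup>* u v" for u v
  proof -
    have "(\<lambda>x y. N x y \<noteq> 0)\<^sup>*\<^sup>* (f u) (f v)" using assms(3) unfolding balanced_matrix_def by blast
    \<comment> \<open>Paths are pulled back step by step along the inverse of
      \<open>f\<close>.\<close>
    then have "(\<lambda>x y. M x y \<noteq> 0)\<^sup>*\<^sup>* (inv f (f u)) (inv f (f v))"
    proof induction
      case (step y z)
      have "M (inv f y) (inv f z) = N y z" using eq[of "inv f y" "inv f z"] f by (simp add: bij_def surj_f_inv_f)
      then show ?case using step by (intro rtranclp.rtrancl_into_rtrancl[OF step.IH]) simp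
    qed simp
    then show ?thesis using f by (simp add: bij_def inv_f_f)
  qed
  show ?thesis
    using assms(3) unfolding balanced_matrix_def card by (intro conjI allI conn square) simp_all
qed

section \<open>The two models are balanced\<close>

text \<open>A nonzero entry of the square yields a walk of length two. This suits both models, whose
  values of \<open>a\<close>, \<open>b\<close>, \<open>c\<close> are all nonzero.\<close>

lemma connected_if_square_nonzero:
  fixes M :: "'v::finite \<Rightarrow> 'v \<Rightarrow> int"
  assumes "\<And>u v. u \<noteq> v \<Longrightarrow> (\<Sum>w\<in>UNIV. M u w * M w v) \<noteq> 0"
  shows "(\<lambda>x y. M x y \<noteq> 0)\<^sup>*\<^sup>* u v"
proof (cases "u = v")
  case False
  obtain w where "M u w * M w v \<noteq> 0"
    using assms[OF False] by (rule sum.not_neutral_contains_not_neutral)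
  then have "M u w \<noteq> 0" "M w v \<noteq> 0" by auto
  then show ?thesis by (meson converse_rtranclp_into_rtranclp r_into_rtranclp)
qed simp

text \<open>Counts the indices avoiding \<open>i\<close> and \<open>j\<close>: an entry of the
  square of \<open>J - I\<close>, which is \<open>2 J + I\<close>.\<close>

lemma sum_indicators_4:
  "(\<Sum>k\<in>(UNIV :: 4 set). of_bool (i \<noteq> k) * of_bool (k \<noteq> j)) = (if i = j then 3 else (2 :: int))"
proof -
  have "(\<Sum>k\<in>(UNIV :: 4 set). of_bool (i \<noteq> k) * of_bool (k \<noteq> j) :: int) =
      (\<Sum>k\<in>UNIV. if k \<in> UNIV - {i, j} then 1 else 0)"
    by (rule sum.cong) auto
  also have "\<dots> = int (card (UNIV - {i, j}))" by (subst sum.If_cases) (simp_all add: set_diff_eq)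
  finally show ?thesis by (simp add: card_Diff_subset)
qed

text \<open>Both halves contribute the same entry of the square of \<open>J - I\<close>, with a plus
  sign inside a half and a minus sign across.\<close>

lemma K4_double_square:
  "(\<Sum>w\<in>UNIV. K4_double u w * K4_double w v) =
    (if u = v then 6 else if K4_double u v = 1 then 4 else if K4_double u v = -1 then -4 else -6)"
proof -
  have "(\<Sum>w\<in>UNIV. K4_double u w * K4_double w v) =
      (\<Sum>k\<in>UNIV. K4_double u (Inl k) * K4_double (Inl k) v) + (\<Sum>k\<in>UNIV. K4_double u (Inr k) * K4_double (Inr k) v)"
    by (subst UNIV_Plus_UNIV[symmetric], subst sum.Plus) simp_all
  then show ?thesis
    by (cases u; cases v) (simp_all add: sum_negf sum_indicators_4)
qed

lemma K4_grid_square: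
  "(\<Sum>w\<in>UNIV. K4_grid u w * K4_grid w v) =
    (if u = v then 6 else if K4_grid u v = 1 then 2 else if K4_grid u v = -1 then 2 else -2)"
proof -
  obtain i j i' j' where uv: "u = (i, j)" "v = (i', j')" by (metis surj_pair)
  have "(\<Sum>w\<in>UNIV. K4_grid u w * K4_grid w v) =
    (\<Sum>k\<in>UNIV. \<Sum>l\<in>UNIV. (of_bool (i = k) - of_bool (j = l)) * (of_bool (k = i') - of_bool (l = j')))"
    unfolding uv UNIV_Times_UNIV[symmetric] sum.cartesian_product' by simp
  \<comment> \<open>The squared terms give the two multiples of 4; each mixed term contributes
    exactly \<open>-1\<close>.\<close>
  also have "\<dots> = 4 * of_bool (i = i') + 4 * of_bool (j = j') - 2"
    by (simp add: algebra_simps sum.distrib sum_subtractf sum_distrib_left[symmetric] sum_distrib_right[symmetric])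
  finally show ?thesis unfolding uv by auto
qed

lemma balanced_K4_double: "balanced_matrix K4_double"
proof -
  have "K4_double (Inl i) w = 1 \<longleftrightarrow> w \<in> Inl ` (UNIV - {i})"
    "K4_double (Inl i) w = -1 \<longleftrightarrow> w \<in> Inr ` (UNIV - {i})"
    "K4_double (Inr i) w = 1 \<longleftrightarrow> w \<in> Inr ` (UNIV - {i})"
    "K4_double (Inr i) w = -1 \<longleftrightarrow> w \<in> Inl ` (UNIV - {i})" for i w
    by (cases w; auto)+
  then have "card {w. K4_double v w = 1} = 3" "card {w. K4_double v w = -1} = 3" for v
    by (cases v; simp add: card_image)+
  moreover have "(\<lambda>x y. K4_double x y \<noteq> 0)\<^sup>*\<^sup>* u v" for u v
    by (rule connected_if_square_nonzero) (simp add: K4_double_square)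
  ultimately show ?thesis
    unfolding balanced_matrix_def by (auto simp: K4_double_square)
qed

lemma balanced_K4_grid: "balanced_matrix K4_grid"
proof -
  have "{w. K4_grid (i, j) w = 1} = {i} \<times> (UNIV - {j})" "{w. K4_grid (i, j) w = -1} = (UNIV - {i}) \<times> {j}" for i j
    by (auto simp: of_bool_def split: if_splits)
  then have "card {w. K4_grid v w = 1} = 3" "card {w. K4_grid v w = -1} = 3" for v
    by (cases v; simp add: card_cartesian_product)+
  moreover have "(\<lambda>x y. K4_grid x y \<noteq> 0)\<^sup>*\<^sup>* u v" for u v
    by (rule connected_if_square_nonzero) (simp add: K4_grid_square)
  ultimately show ?thesis
    unfolding balanced_matrix_def by (auto simp: K4_grid_square)
qed

lemma S8_signed_adj: "signed_graph S8" "signed_adj S8 = K4_double"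
proof -
  have "card e = 2" if "e \<in> S8_pos_edges \<union> S8_neg_edges" for e
    using that unfolding S8_pos_edges_def S8_neg_edges_def by auto
  then show "signed_graph S8" unfolding signed_graph_def S8_def by simp
  show "signed_adj S8 = K4_double"
  proof (intro ext)
    fix u v show "signed_adj S8 u v = K4_double u v"
      by (cases u; cases v) (auto simp: signed_adj_def adjacent_def S8_def S8_pos_edges_def
        S8_neg_edges_def doubleton_eq_iff)
  qed
qed

lemma S16_edges_iff:
  "{(i, j), (i', j')} \<in> S16_pos_edges \<longleftrightarrow> i = i' \<and> j \<noteq> j'"
  "{(i, j), (i', j')} \<in> S16_neg_edges \<longleftrightarrow> i \<noteq> i' \<and> j = j'"
  unfolding S16_pos_edges_def S16_neg_edges_def by (auto simp: doubleton_eq_iff)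

lemma S16_signed_adj: "signed_graph S16" "signed_adj S16 = K4_grid"
proof -
  show "signed_graph S16"
    by (auto simp: signed_graph_def S16_def S16_pos_edges_def S16_neg_edges_def)
  show "signed_adj S16 = K4_grid"
  proof (intro ext)
    fix u v show "signed_adj S16 u v = K4_grid u v"
      by (cases u; cases v) (auto simp: signed_adj_def adjacent_def S16_def S16_edges_iff)
  qed
qed

lemma srsg_S8: "srsg_with_params S8 8 6 4 (-4) (-6)"
proof -
  have "{Inl 0, Inr 1} \<notin> S8_pos_edges" by (auto simp: S8_pos_edges_def doubleton_eq_iff)
  moreover have "{Inl 0, Inl 1} \<in> S8_pos_edges" "{Inl 0, Inr 1} \<in> S8_neg_edges"
    by (force simp: S8_pos_edges_def S8_neg_edges_def)+
  ultimately have "\<not> homogeneous S8" "edges S8 \<noteq> {}"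
    using not_homogeneousI[of "{Inl 0, Inr 1}" S8 "{Inl 0, Inl 1}"] by (auto simp: S8_def)
  then show ?thesis
    unfolding srsg_with_params_def square_signed_adj square_entry_eq[OF S8_signed_adj(1)]
    by (simp add: S8_signed_adj K4_double_square)
qed

lemma srsg_S16: "srsg_with_params S16 16 6 2 2 (-2)"
proof -
  have "{(0, 0), (1, 0)} \<notin> S16_pos_edges" by (auto simp: S16_pos_edges_def doubleton_eq_iff)
  moreover have "{(0, 0), (0, 1)} \<in> S16_pos_edges" "{(0, 0), (1, 0)} \<in> S16_neg_edges"
    by (force simp: S16_pos_edges_def S16_neg_edges_def)+
  ultimately have "\<not> homogeneous S16" "edges S16 \<noteq> {}"
    using not_homogeneousI[of "{(0, 0), (1, 0)}" S16 "{(0, 0), (0, 1)}"] by (auto simp: S16_def)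
  then show ?thesis
    unfolding srsg_with_params_def square_signed_adj square_entry_eq[OF S16_signed_adj(1)]
    by (simp add: S16_signed_adj K4_grid_square)
qed

theorem theorem3p32:
  fixes G :: "'v::finite sgraph"
  assumes "signed_graph G"
  shows "((sg_connected G \<and> sg_regular G 6 \<and> strongly_regular G \<and> net_regular G 0) \<longleftrightarrow>
            (sg_isomorphic G S8 \<or> sg_isomorphic G (negation S8) \<or>
             sg_isomorphic G S16 \<or> sg_isomorphic G (negation S16))) \<and>
         srsg_with_params S8 8 6 4 (-4) (-6) \<and>
         srsg_with_params S16 16 6 2 2 (-2)"
proof -
  let ?M = "signed_adj G"
  have iso: "sg_isomorphic G S8 \<longleftrightarrow> (\<exists>f. bij f \<and> (\<forall>u v. K4_double (f u) (f v) = ?M u v))"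
    "sg_isomorphic G S16 \<longleftrightarrow> (\<exists>f. bij f \<and> (\<forall>u v. K4_grid (f u) (f v) = ?M u v))"
    using sg_isomorphic_iff[OF assms S8_signed_adj(1)] sg_isomorphic_iff[OF assms S16_signed_adj(1)] by (simp_all add: S8_signed_adj S16_signed_adj)
  \<comment> \<open>Moves the sign from the model to the matrix of \<open>G\<close>, the form in
    which \<open>neg.classification\<close> delivers it.\<close>
  have m: "- x = y \<longleftrightarrow> x = - y" for x y :: int by auto
  have iso_neg: "sg_isomorphic G (negation S8) \<longleftrightarrow> (\<exists>f. bij f \<and> (\<forall>u v. K4_double (f u) (f v) = - ?M u v))"
    "sg_isomorphic G (negation S16) \<longleftrightarrow> (\<exists>f. bij f \<and> (\<forall>u v. K4_grid (f u) (f v) = - ?M u v))"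
    unfolding sg_isomorphic_iff[OF assms signed_graph_negation[OF S8_signed_adj(1)]]
      sg_isomorphic_iff[OF assms signed_graph_negation[OF S16_signed_adj(1)]]
      signed_adj_negation S8_signed_adj(2) S16_signed_adj(2) m by (rule refl)+
  have "balanced_matrix ?M \<longleftrightarrow> sg_isomorphic G S8 \<or> sg_isomorphic G (negation S8) \<or>
      sg_isomorphic G S16 \<or> sg_isomorphic G (negation S16)"
  proof
    assume bal: "balanced_matrix ?M"
    then obtain a b c where "\<And>u v. u \<noteq> v \<Longrightarrow> (\<Sum>w\<in>UNIV. ?M u w * ?M w v) =
        (if ?M u v = 1 then a else if ?M u v = -1 then b else c)"
      unfolding balanced_matrix_def by blast
    then interpret balanced_srsg ?M a b c
      using bal signed_adj_sym signed_adj_diag[OF assms] signed_adj_cases[OF assms]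
      by unfold_locales (auto simp: balanced_matrix_def)
    \<comment> \<open>Negation leaves the square unchanged and swaps \<open>a\<close> with
      \<open>b\<close>, so \<open>classification\<close> applies to the matrix or to its
      negative.\<close>
    interpret neg: balanced_srsg "\<lambda>u v. - ?M u v" b a c
    proof
      fix u v
      show "- ?M u v = - ?M v u" "- ?M u u = 0" "- ?M u v = -1 \<or> - ?M u v = 0 \<or> - ?M u v = 1"
        using sym diag vals[of u v] by auto
      have "{w. - ?M u w = 1} = {w. ?M u w = -1}" "{w. - ?M u w = -1} = {w. ?M u w = 1}" by auto
      then show "card {w. - ?M u w = 1} = 3" "card {w. - ?M u w = -1} = 3" using pos3 neg3 by simp_all
      show "(\<Sum>w\<in>UNIV. - ?M u w * - ?M w v) = (if - ?M u v = 1 then b else if - ?M u v = -1 then a else c)"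
        if "u \<noteq> v" using square[OF that] vals[of u v] by auto
    qed
    show "sg_isomorphic G S8 \<or> sg_isomorphic G (negation S8) \<or>
      sg_isomorphic G S16 \<or> sg_isomorphic G (negation S16)"
    proof (cases "a \<ge> b")
      case True
      then show ?thesis unfolding iso iso_neg using classification by blast
    next
      case False
      then have "b \<ge> a" by simp
      from neg.classification[OF this] show ?thesis unfolding iso iso_neg by blast
    qed
  next
    \<comment> \<open>For a negated model, balance is transferred to the negative of the matrix and
      then negated back.\<close>
    have *: "balanced_matrix (\<lambda>u v. - (- ?M u v)) \<Longrightarrow> balanced_matrix ?M" by simp
    assume "sg_isomorphic G S8 \<or> sg_isomorphic G (negation S8) \<or>
      sg_isomorphic G S16 \<or> sg_isomorphic G (negation S16)"
    then show "balanced_matrix ?M"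
      unfolding iso iso_neg
    proof (elim disjE exE conjE)
      fix f assume "bij f" "\<forall>u v. K4_double (f u) (f v) = ?M u v"
      then show ?thesis by (intro balanced_matrix_transfer[OF _ _ balanced_K4_double]) auto
    next
      fix f assume "bij f" "\<forall>u v. K4_double (f u) (f v) = - ?M u v"
      then show ?thesis by (intro *[OF balanced_matrix_uminus[OF balanced_matrix_transfer[OF _ _ balanced_K4_double]]]) auto
    next
      fix f assume "bij f" "\<forall>u v. K4_grid (f u) (f v) = ?M u v"
      then show ?thesis by (intro balanced_matrix_transfer[OF _ _ balanced_K4_grid]) auto
    next
      fix f assume "bij f" "\<forall>u v. K4_grid (f u) (f v) = - ?M u v"
      then show ?thesis by (intro *[OF balanced_matrix_uminus[OF balanced_matrix_transfer[OF _ _ balanced_K4_grid]]]) auto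
    qed
  qed
  then show ?thesis using balanced_srsg_iff[OF assms] srsg_S8 srsg_S16 by blast
qed

end
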